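(* Let $P \in \mathbb{R}[x]$ be a polynomial whose coefficient of $x$, denoted $\alpha$, is non-Liouville. For natural numbers $d, m$ and real $X>0$ put $$s_m(X) := \sum_{x \le X} e\!\left(m\,\frac{P(dx)}{d}\right),$$ the sum being over natural numbers $x \le X$. Then there exist constants $\tau, \rho, X_0 > 0$ such that $$|s_m(X)| \le X^{1-\tau}$$ for all natural numbers $d$, all natural numbers $m < X^{\rho}$, and all $X \ge X_0$.
   Context: $e(t) := e^{2\pi i t}$. A real number $\alpha$ is called Liouville if for every $n \in \mathbb{N}$ there exists a pair of integers $(p,q)$ with $q>1$ such that $\left|\alpha - \frac{p}{q}\right| \le q^{-n}$; it is non-Liouville if it is not Liouville. *)

theory Defs
  imports Complex_Main "HOL-Computational_Algebra.Polynomial"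
begin

text \<open>Natural numbers in the source start at 1, hence the positivity guards below.
  Rational numbers are Liouville in this sense (write the fraction with denominator \<open>q > 1\<close>).\<close>

definition liouville :: "real \<Rightarrow> bool" where
  "liouville \<alpha> \<longleftrightarrow>
     (\<forall>n::nat. n \<ge> 1 \<longrightarrow>
       (\<exists>p q :: int. q > 1 \<and> \<bar>\<alpha> - real_of_int p / real_of_int q\<bar> \<le> real_of_int q powi (- int n)))"

definition e :: "real \<Rightarrow> complex" where
  "e t = exp (2 * complex_of_real pi * \<i> * complex_of_real t)"

definition exp_sum :: "real poly \<Rightarrow> nat \<Rightarrow> nat \<Rightarrow> real \<Rightarrow> complex" where
  "exp_sum P d m X =
     (\<Sum>x \<in> {x::nat. x \<ge> 1 \<and> real x \<le> X}. e (real m * (poly P (real d * real x) / real d)))"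

end

theory Submission imports Defs "HOL-Analysis.Complex_Transcendental" begin

text \<open>If an exponential sum over a real polynomial of length \<open>N\<close> exceeds \<open>N / K\<close>, then all
  non-constant coefficients are simultaneously close to rationals with one denominator
  \<open>q \<le> K ^ A\<close>: the \<open>j\<close>-th one satisfies \<open>int_dist (q * b j) \<le> K ^ A / N ^ j\<close>.  This is shown by
  induction on the degree.  Van der Corput differencing and the induction hypothesis control the
  leading coefficient; on progressions of difference \<open>q\<close> and length slightly below \<open>N\<close> the leading
  term is then almost constant modulo 1, so the induction hypothesis applies to the remaining terms.

  For the phase \<open>m P(d x) / d\<close> the linear coefficient is \<open>m \<alpha>\<close> whatever \<open>d\<close> is.  With \<open>K\<close> and \<open>m\<close>
  small powers of \<open>X\<close>, a large sum would give an approximation of \<open>\<alpha>\<close> with denominator \<open>q m\<close> that is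
  too good for a non-Liouville number.\<close>

section \<open>Distance to the nearest integer\<close>

definition int_dist :: "real \<Rightarrow> real" where
  "int_dist x = \<bar>x - of_int (round x)\<bar>"

lemma int_dist_le: "int_dist x \<le> \<bar>x - of_int n\<bar>"
  unfolding int_dist_def by (rule round_diff_minimal)

lemma int_dist_obtain:
  obtains n :: int where "\<bar>x - of_int n\<bar> = int_dist x"
  using int_dist_def by metis

lemma int_dist_nonneg [simp]: "0 \<le> int_dist x"
  by (simp add: int_dist_def)

lemma int_dist_le_half: "int_dist x \<le> 1/2"
  unfolding int_dist_def using of_int_round_abs_le[of x] by (simp add: abs_minus_commute)

lemma int_dist_add: "int_dist (x + y) \<le> int_dist x + int_dist y"
proof -
  have "int_dist (x + y) \<le> \<bar>x + y - of_int (round x + round y)\<bar>"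
    by (rule int_dist_le)
  then show ?thesis
    unfolding int_dist_def[of x] int_dist_def[of y] by simp
qed

lemma int_dist_mult_int: "int_dist (of_int c * x) \<le> \<bar>of_int c\<bar> * int_dist x"
proof -
  have "int_dist (of_int c * x) \<le> \<bar>of_int c * x - of_int (c * round x)\<bar>"
    by (rule int_dist_le)
  also have "\<dots> = \<bar>of_int c\<bar> * int_dist x"
    unfolding int_dist_def abs_mult[symmetric] by (simp add: algebra_simps)
  finally show ?thesis .
qed

lemma int_dist_mult_nat: "int_dist (real c * x) \<le> real c * int_dist x"
  using int_dist_mult_int[of "int c" x] by simp

lemma int_dist_sum: "int_dist (\<Sum>i\<in>I. f i) \<le> (\<Sum>i\<in>I. int_dist (f i))"
proof (induction I rule: infinite_finite_induct)
  case (insert i I)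
  then show ?case
    using int_dist_add[of "f i" "\<Sum>i\<in>I. f i"] by simp
qed (simp_all add: int_dist_def)

section \<open>Exponential sums\<close>

lemma e_add: "e (x + y) = e x * e y"
  by (simp add: e_def ring_distribs exp_add)

lemma norm_e [simp]: "norm (e t) = 1"
  by (simp add: e_def)

lemma e_of_int [simp]: "e (of_int n) = 1"
  unfolding e_def using exp_integer_2pi[of "real_of_int n"] by (simp add: mult_ac)

lemma e_mult_of_nat: "e (real n * t) = e t ^ n"
  by (simp add: e_def exp_of_nat_mult[symmetric] mult_ac)

lemma e_diff: "e (x - y) = e x * cnj (e y)"
proof -
  have "e (x - y) * e y = e x"
    by (simp flip: e_add)
  moreover have "e y * cnj (e y) = 1"
    by (simp add: complex_norm_square[symmetric])
  ultimately show ?thesis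
    by (metis mult.assoc mult.right_neutral)
qed

lemma norm_e_minus_1: "norm (e t - 1) = 2 * \<bar>sin (pi * t)\<bar>"
  using dist_exp_i_1[of "2 * pi * t"] by (simp add: e_def mult_ac)

lemma norm_e_minus_1_le: "norm (e t - 1) \<le> 8 * \<bar>t\<bar>"
proof -
  have "\<bar>sin (pi * t)\<bar> \<le> pi * \<bar>t\<bar>"
    using abs_sin_x_le_abs_x[of "pi * t"] by (simp add: abs_mult)
  also have "\<dots> \<le> 4 * \<bar>t\<bar>"
    using pi_less_4 by (intro mult_right_mono) auto
  finally show ?thesis
    by (simp add: norm_e_minus_1)
qed

text \<open>By periodicity \<open>t\<close> may be replaced by \<open>u\<close> with
  \<open>\<bar>u\<bar> \<le> 1/2\<close>. For \<open>x = pi * u\<close> the cubic Taylor bound gives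
  \<open>\<bar>sin x - x\<bar> \<le> 2/3 * \<bar>x\<bar>\<close>, so the sine is at least a third of
  its argument, and \<open>pi \<ge> 2\<close> leaves room to spare.\<close>

lemma int_dist_le_norm_e: "int_dist t \<le> norm (e t - 1)"
proof -
  define u where "u = t - of_int (round t)"
  have u: "\<bar>u\<bar> = int_dist t"
    by (simp add: u_def int_dist_def)
  have "e t = e (u + of_int (round t))"
    by (simp add: u_def)
  then have eu: "e t = e u"
    by (simp add: e_add)
  define x where "x = pi * u"
  have "\<bar>x\<bar> \<le> pi * (1/2)"
    unfolding x_def abs_mult using u int_dist_le_half[of t] by (intro mult_mono) auto
  then have x2: "\<bar>x\<bar> \<le> 2"
    using pi_half_le_two by linarith
  have "\<bar>sin x - x\<bar> \<le> \<bar>x\<bar> ^ 3 / 6"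
    using Maclaurin_sin_bound[of x 3] by (simp add: numeral_eq_Suc sin_coeff_def field_simps)
  also have "\<bar>x\<bar> ^ 3 / 6 \<le> \<bar>x\<bar> * (2 * 2) / 6"
    unfolding power3_eq_cube mult.assoc using x2 by (intro divide_right_mono mult_left_mono mult_mono) auto
  finally have "\<bar>x\<bar> \<le> 3 * \<bar>sin x\<bar>"
    by linarith
  moreover have "2 * \<bar>u\<bar> \<le> \<bar>x\<bar>"
    unfolding x_def abs_mult using pi_ge_two by (intro mult_right_mono) auto
  ultimately show ?thesis
    using u by (simp add: eu norm_e_minus_1 x_def)
qed

text \<open>Multiplying the geometric sum by \<open>e t - 1\<close> telescopes it to two terms of
  modulus 1. The product form also covers integral \<open>t\<close>, where no division is
  possible.\<close>

lemma geometric_e_sum: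
  "int_dist t * norm (\<Sum>x=1..N. e (c + t * real x)) \<le> 2"
proof -
  define S where "S = (\<Sum>x=1..N. e t ^ x)"
  have *: "(\<Sum>x=1..N. e (c + t * real x)) = e c * S"
    unfolding S_def sum_distrib_left
    by (intro sum.cong) (simp_all add: e_add e_mult_of_nat[symmetric] mult.commute)
  have "(e t - 1) * S = e t ^ Suc N - e t"
    unfolding S_def by (induction N) (simp_all add: algebra_simps)
  then have "norm (e t - 1) * norm S = norm (e t ^ Suc N - e t)"
    by (metis norm_mult)
  also have "\<dots> \<le> 2"
    using norm_triangle_ineq4[of "e t ^ Suc N" "e t"] by (simp add: norm_mult norm_power)
  finally have "int_dist t * norm S \<le> 2"
    using mult_right_mono[OF int_dist_le_norm_e[of t], of "norm S"] by simp
  then show ?thesis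
    unfolding * norm_mult by simp
qed

text \<open>Expand the square into pairs of points and group them by their difference
  \<open>h\<close>. Pairs in decreasing order give the complex conjugates of those in increasing
  order, whence the factor 2. All shifts \<open>h < N\<close> are kept, which suffices for a bound
  with power losses.\<close>

lemma van_der_corput:
  fixes f :: "nat \<Rightarrow> real"
  shows "(norm (\<Sum>x=1..N. e (f x)))\<^sup>2 \<le> 2 * (\<Sum>h<N. norm (\<Sum>x=1..N-h. e (f (x + h) - f x)))"
proof -
  define T where "T h = (\<Sum>x=1..N-h. e (f (x + h) - f x))" for h
  define g where "g p = e (f (snd p) - f (fst p))" for p
  let ?P = "{1..N} \<times> {1..N}"
  let ?A = "{p \<in> ?P. fst p \<le> snd p}" and ?B = "{p \<in> ?P. snd p < fst p}"
  have "(\<Sum>x=1..N. e (f x)) * cnj (\<Sum>x=1..N. e (f x)) = (\<Sum>y=1..N. \<Sum>x=1..N. e (f y - f x))"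
    by (simp add: e_diff cnj_sum sum_product)
  also have "\<dots> = (\<Sum>x=1..N. \<Sum>y=1..N. e (f y - f x))"
    by (rule sum.swap)
  also have "\<dots> = sum g ?P"
    by (simp add: sum.cartesian_product g_def case_prod_beta)
  also have "\<dots> = sum g ?A + sum g ?B"
    by (subst sum.union_disjoint[symmetric]) (auto intro!: sum.cong)
  also have "sum g ?A = (\<Sum>(h, x)\<in>(SIGMA h:{..<N}. {1..N-h}). e (f (x + h) - f x))"
    by (rule sum.reindex_bij_witness[where i = "\<lambda>(h, x). (x, x + h)" and j = "\<lambda>(x, y). (y - x, x)"])
      (auto simp: g_def)
  also have "\<dots> = sum T {..<N}"
    unfolding T_def by (rule sum.Sigma[symmetric]) auto
  also have "sum g ?B = (\<Sum>(h, x)\<in>(SIGMA h:{1..<N}. {1..N-h}). cnj (e (f (x + h) - f x)))"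
    by (rule sum.reindex_bij_witness[where i = "\<lambda>(h, x). (x + h, x)" and j = "\<lambda>(x, y). (x - y, y)"])
      (auto simp: g_def e_diff)
  also have "\<dots> = (\<Sum>h\<in>{1..<N}. cnj (T h))"
    unfolding T_def cnj_sum by (rule sum.Sigma[symmetric]) auto
  finally have "norm ((\<Sum>x=1..N. e (f x)) * cnj (\<Sum>x=1..N. e (f x))) \<le>
      norm (sum T {..<N}) + norm (\<Sum>h\<in>{1..<N}. cnj (T h))"
    by (simp only: norm_triangle_ineq)
  also have "norm (sum T {..<N}) \<le> (\<Sum>h<N. norm (T h))"
    by (rule norm_sum)
  also have "norm (\<Sum>h\<in>{1..<N}. cnj (T h)) \<le> (\<Sum>h\<in>{1..<N}. norm (T h))"
    by (rule order_trans[OF norm_sum]) simp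
  also have "\<dots> \<le> (\<Sum>h<N. norm (T h))"
    by (intro sum_mono2) auto
  finally show ?thesis
    unfolding T_def norm_mult complex_mod_cnj power2_eq_square by simp
qed

section \<open>Coefficients of polynomials\<close>

definition polyfun :: "nat \<Rightarrow> (nat \<Rightarrow> real) \<Rightarrow> real \<Rightarrow> real" where
  "polyfun k b x = (\<Sum>i\<le>k. b i * x ^ i)"

text \<open>The binomial coefficient vanishes for \<open>i < j\<close>, where \<open>i - j\<close> is truncated.\<close>

definition affine_coeffs :: "nat \<Rightarrow> (nat \<Rightarrow> real) \<Rightarrow> real \<Rightarrow> real \<Rightarrow> nat \<Rightarrow> real" where
  "affine_coeffs k b q s j = (\<Sum>i\<le>k. b i * real (i choose j) * q ^ j * s ^ (i - j))"

lemma polyfun_affine: "polyfun k b (q * y + s) = polyfun k (affine_coeffs k b q s) y"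
proof -
  have "b i * (q * y + s) ^ i = (\<Sum>j\<le>k. b i * real (i choose j) * q ^ j * s ^ (i - j) * y ^ j)"
    if "i \<le> k" for i
  proof -
    have "(q * y + s) ^ i = (\<Sum>j\<le>i. real (i choose j) * (q * y) ^ j * s ^ (i - j))"
      by (simp add: binomial_ring)
    also have "\<dots> = (\<Sum>j\<le>k. real (i choose j) * (q * y) ^ j * s ^ (i - j))"
      using that by (intro sum.mono_neutral_left) (auto simp: binomial_eq_0)
    finally show ?thesis
      by (simp add: sum_distrib_left power_mult_distrib mult_ac)
  qed
  then have "polyfun k b (q * y + s) =
      (\<Sum>i\<le>k. \<Sum>j\<le>k. b i * real (i choose j) * q ^ j * s ^ (i - j) * y ^ j)"
    unfolding polyfun_def by simp
  also have "\<dots> = (\<Sum>j\<le>k. \<Sum>i\<le>k. b i * real (i choose j) * q ^ j * s ^ (i - j) * y ^ j)"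
    by (rule sum.swap)
  finally show ?thesis
    unfolding polyfun_def affine_coeffs_def by (simp add: sum_distrib_right)
qed

text \<open>The two substitutions cancel as functions, and a polynomial function determines its
  coefficients. This recovers the original coefficients from those on a progression.\<close>

lemma affine_coeffs_inverse:
  assumes "q \<noteq> 0" "j \<le> k"
  shows "affine_coeffs k (affine_coeffs k b q s) (1 / q) (- s / q) j = b j"
proof -
  have "polyfun k (affine_coeffs k (affine_coeffs k b q s) (1 / q) (- s / q)) x = polyfun k b x" for x
    using assms by (simp add: polyfun_affine[symmetric] field_simps)
  then show ?thesis
    unfolding polyfun_def using polyfun_eq_coeffs[of _ k b] assms(2) by blast
qed

lemma polyfun_Suc: "polyfun (Suc k) b x = polyfun k b x + b (Suc k) * x ^ Suc k"
  by (simp add: polyfun_def)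

lemma affine_coeffs_shift_top:
  "affine_coeffs (Suc k) b 1 h (Suc k) = b (Suc k)"
proof -
  have "affine_coeffs (Suc k) b 1 h (Suc k) =
      (\<Sum>i\<in>{Suc k}. b i * real (i choose Suc k) * 1 ^ Suc k * h ^ (i - Suc k))"
    unfolding affine_coeffs_def by (intro sum.mono_neutral_right) (auto simp: binomial_eq_0)
  then show ?thesis by simp
qed

text \<open>After subtraction of \<open>b k\<close> this is linear in \<open>h\<close> with slope
  \<open>(k + 1) * b (k + 1)\<close>: differencing exposes the leading coefficient through its
  multiples by \<open>h\<close>.\<close>

lemma affine_coeffs_shift_second:
  "affine_coeffs (Suc k) b 1 h k = b k + real (Suc k) * b (Suc k) * h"
proof -
  have "affine_coeffs (Suc k) b 1 h k =
      (\<Sum>i\<in>{k, Suc k}. b i * real (i choose k) * 1 ^ k * h ^ (i - k))"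
    unfolding affine_coeffs_def by (intro sum.mono_neutral_right) (auto simp: binomial_eq_0)
  then show ?thesis by simp
qed

section \<open>Inverse theorem for Weyl sums\<close>

text \<open>No lower bound on \<open>N\<close> in terms of \<open>K\<close> is needed: for \<open>N\<close> below a fixed power of \<open>K\<close>
  the conclusion holds with \<open>q = 1\<close>, as soon as \<open>A\<close> is large.\<close>

definition weyl_inverse :: "nat \<Rightarrow> nat \<Rightarrow> bool" where
  "weyl_inverse k A \<longleftrightarrow>
     (\<forall>b N K. K \<ge> 2 \<longrightarrow> real N \<le> real K * norm (\<Sum>x=1..N. e (polyfun k b (real x))) \<longrightarrow>
       (\<exists>q\<ge>1. q \<le> K ^ A \<and> (\<forall>j\<in>{1..k}. int_dist (real q * b j) * real N ^ j \<le> real K ^ A)))"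

text \<open>The geometric sum bound gives this with denominator 1; its constant 2 is absorbed by one
  factor \<open>K\<close>.\<close>

lemma weyl_inverse_1: "weyl_inverse 1 2"
  unfolding weyl_inverse_def
proof (intro allI impI)
  fix b :: "nat \<Rightarrow> real" and N K :: nat
  assume K: "K \<ge> 2" and S: "real N \<le> real K * norm (\<Sum>x=1..N. e (polyfun 1 b (real x)))"
  have "int_dist (b 1) * real N \<le> real K * (int_dist (b 1) * norm (\<Sum>x=1..N. e (polyfun 1 b (real x))))"
    using mult_left_mono[OF S int_dist_nonneg[of "b 1"]] by (simp only: mult_ac)
  also have "\<dots> \<le> real K * 2"
    using geometric_e_sum[of "b 1" "b 0" N] by (intro mult_left_mono) (auto simp: polyfun_def)
  also have "\<dots> \<le> real K ^ 2"
    using K by (simp add: power2_eq_square)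
  finally show "\<exists>q\<ge>1. q \<le> K ^ 2 \<and> (\<forall>j\<in>{1..1}. int_dist (real q * b j) * real N ^ j \<le> real K ^ 2)"
    using K by (intro exI[of _ 1]) auto
qed

text \<open>Two elements of \<open>H\<close> in a common short block give a multiplier \<open>q < 2 K\<close> with
  \<open>int_dist (q * \<gamma>)\<close> of size \<open>K / N ^ m\<close>.  The error is then small enough that along an
  arithmetic progression of difference \<open>q\<close> and length about \<open>N / K\<close> the multiples of \<open>\<gamma>\<close>
  drift linearly without wrapping around; two far apart elements of \<open>H\<close> on such a
  progression gain the extra factor \<open>N\<close>.\<close>

lemma int_dist_gain:
  fixes \<gamma> :: real
  assumes K: "K \<ge> 2" and m: "m \<ge> 1" and H: "H \<subseteq> {..<N}" "N \<le> K * card H"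
    and small: "\<And>h. h \<in> H \<Longrightarrow> int_dist (\<gamma> * real h) * real N ^ m \<le> real K"
  shows "\<exists>q\<ge>1. q \<le> K ^ (12 * Suc m) \<and> int_dist (real q * \<gamma>) * real N ^ Suc m \<le> real K ^ (12 * Suc m)"
proof (cases "N \<le> K ^ 10")
  case True
  \<comment> \<open>For small \<open>N\<close> the multiplier 1 works, since
    \<open>N ^ (m + 1)\<close> is itself at most a power of \<open>K\<close>.\<close>
  have "int_dist (real 1 * \<gamma>) * real N ^ Suc m \<le> 1 * (real K ^ 10) ^ Suc m"
    using True int_dist_le_half[of \<gamma>] by (intro mult_mono power_mono) (auto simp flip: of_nat_power)
  also have "\<dots> \<le> real K ^ (12 * Suc m)"
    using K unfolding mult_1 power_mult[symmetric] by (intro power_increasing) auto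
  finally show ?thesis
    using K by (intro exI[of _ 1]) auto
next
  case False
  have "(2::nat) ^ 7 * K ^ 3 \<le> K ^ 7 * K ^ 3"
    using K by (intro mult_right_mono power_mono) auto
  with False have N: "N > 128 * K ^ 3"
    by (simp flip: power_add)
  have K3: "K ^ 3 \<ge> 4 * K"
    using mult_mono[of 2 K 2 K] K by (simp add: power3_eq_cube)
  have fin: "finite H"
    using H finite_subset by blast
  \<comment> \<open>With at most one element per block of length \<open>2 * K\<close>,
    \<open>card H \<le> N div (2 * K) + 1\<close>, so
    \<open>N \<le> K * card H \<le> N / 2 + K\<close>, impossible for this large
    \<open>N\<close>.\<close>
  have "\<not> inj_on (\<lambda>h. h div (2 * K)) H"
  proof
    assume "inj_on (\<lambda>h. h div (2 * K)) H"
    moreover have "(\<lambda>h. h div (2 * K)) ` H \<subseteq> {..N div (2 * K)}"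
      using H by (auto intro!: div_le_mono)
    ultimately have "card H \<le> card {..N div (2 * K)}"
      using card_inj_on_le by blast
    then have "K * card H \<le> K * (N div (2 * K)) + K"
      using mult_le_mono2[of "card H" "Suc (N div (2 * K))" K] by simp
    moreover have "2 * K * (N div (2 * K)) \<le> N"
      by (rule times_div_less_eq_dividend)
    ultimately show False
      using H N K3 by simp
  qed
  then obtain h1 h2 where h12: "h1 \<in> H" "h2 \<in> H" "h1 < h2" "h1 div (2 * K) = h2 div (2 * K)"
    unfolding inj_on_def by (metis linorder_neqE_nat)
  define q where "q = h2 - h1"
  have q: "q \<ge> 1" "q < 2 * K"
  proof -
    show "q \<ge> 1"
      using h12 by (simp add: q_def)
    have "h2 < 2 * K * (h2 div (2 * K)) + 2 * K"
      using dividend_less_times_div[of "2 * K" h2] K by linarith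
    moreover have "2 * K * (h1 div (2 * K)) \<le> h1"
      by (rule times_div_less_eq_dividend)
    ultimately show "q < 2 * K"
      using h12 by (simp add: q_def)
  qed
  have diff_small: "int_dist (\<gamma> * (real y - real x)) * real N ^ m \<le> 2 * real K" if "x \<in> H" "y \<in> H" for x y
  proof -
    have "int_dist (\<gamma> * (real y - real x)) \<le> int_dist (\<gamma> * real y) + int_dist (of_int (-1) * (\<gamma> * real x))"
      using int_dist_add[of "\<gamma> * real y" "- (\<gamma> * real x)"] by (simp add: algebra_simps)
    also have "\<dots> \<le> int_dist (\<gamma> * real y) + int_dist (\<gamma> * real x)"
      using int_dist_mult_int[of "-1" "\<gamma> * real x"] by simp
    finally have "int_dist (\<gamma> * (real y - real x)) * real N ^ m \<le>
        (int_dist (\<gamma> * real y) + int_dist (\<gamma> * real x)) * real N ^ m"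
      by (intro mult_right_mono) auto
    then show ?thesis
      using small[OF that(1)] small[OF that(2)] by (simp add: ring_distribs)
  qed
  obtain a :: int where a: "\<bar>real q * \<gamma> - of_int a\<bar> = int_dist (real q * \<gamma>)"
    by (rule int_dist_obtain)
  define \<theta> where "\<theta> = real q * \<gamma> - of_int a"
  have \<theta>: "\<bar>\<theta>\<bar> * real N ^ m \<le> 2 * real K"
    using diff_small[OF h12(1,2)] h12(3) a by (simp add: \<theta>_def q_def of_nat_diff mult.commute)
  \<comment> \<open>The longest progression without wrap-around: for \<open>D < W\<close>,
    \<open>\<bar>\<theta>\<bar> * D \<le> \<bar>\<theta>\<bar> * N ^ m / (8 * K) \<le> 1/4\<close>,
    as \<open>N \<le> N ^ m\<close>.\<close>
  define W where "W = N div (8 * K)"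
  have W1: "8 * K * W \<le> N"
    unfolding W_def by (rule times_div_less_eq_dividend)
  have W2: "N < 8 * K * W + 8 * K"
    using dividend_less_times_div[of "8 * K" N] K unfolding W_def by linarith
  have "8 * K * 2 \<le> N"
    using N K3 by simp
  then have W3: "W \<ge> 1"
    using W2 K by (cases W) auto
  have W4: "N \<le> 16 * K * W"
    using W2 mult_le_mono2[OF W3, of "8 * K"] by linarith
  \<comment> \<open>Colour \<open>h\<close> by its residue modulo \<open>q\<close> and by the block
    of length \<open>W\<close> containing its quotient. There are at most
    \<open>34 * K\<^sup>2\<close> colours, so one class \<open>E\<close> still has at least
    \<open>N / (34 * K ^ 3)\<close> elements.\<close>
  define c where "c h = (h mod q, (h div q) div W)" for h
  define C where "C = {..<q} \<times> {..16 * K}"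
  have "c h \<in> C" if "h \<in> H" for h
  proof -
    have "(h div q) div W \<le> N div W"
      using that H by (intro div_le_mono) (metis div_le_dividend le_trans lessThan_iff nat_less_le subsetD)
    also have "\<dots> \<le> (16 * K * W) div W"
      using W4 by (rule div_le_mono)
    finally show ?thesis
      using W3 q by (simp add: c_def C_def)
  qed
  then have "\<exists>z\<in>C. card (c -` {z} \<inter> H) * card C \<ge> card H"
    using fin q by (intro pigeonhole_card) (auto simp: C_def lessThan_empty_iff)
  then obtain z where z: "card (c -` {z} \<inter> H) * card C \<ge> card H"
    by blast
  define E where "E = c -` {z} \<inter> H"
  have finE: "finite E" and EH: "E \<subseteq> H"
    using fin by (auto simp: E_def)
  have "card C \<le> 2 * K * (16 * K + 1)"
    unfolding C_def card_cartesian_product using q by (intro mult_le_mono) auto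
  also have "\<dots> \<le> 34 * K\<^sup>2"
    using K by (simp add: power2_eq_square algebra_simps)
  finally have "N \<le> K * (card E * (34 * K\<^sup>2))"
    using z H(2) unfolding E_def[symmetric]
    by (meson le_trans mult_le_mono2)
  then have cardE: "N \<le> 34 * K ^ 3 * card E"
    by (simp add: power2_eq_square power3_eq_cube mult_ac)
  have "card E > 0"
    using cardE N by (auto intro!: gr0I)
  then have Ene: "E \<noteq> {}"
    by auto
  have inj: "inj_on (\<lambda>h. h div q) E"
  proof
    fix x y assume "x \<in> E" "y \<in> E" "x div q = y div q"
    moreover from this have "x mod q = y mod q"
      by (auto simp: E_def c_def)
    ultimately show "x = y"
      by (metis div_mult_mod_eq)
  qed
  define F where "F = (\<lambda>h. h div q) ` E"
  have F: "finite F" "F \<noteq> {}" "card F = card E"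
    using finE Ene inj by (auto simp: F_def card_image)
  \<comment> \<open>Distinct quotients spread at least as far as their number minus one. Since
    \<open>N > 128 * K ^ 3\<close>, that one costs only a factor 2, giving
    \<open>N \<le> 68 * K ^ 3 * D\<close>.\<close>
  define D where "D = Max F - Min F"
  have "F \<subseteq> {Min F..Max F}"
    using F by auto
  then have "card F \<le> D + 1"
    using card_mono[of "{Min F..Max F}" F] F Min_le[of F "Max F"] by (simp add: D_def Suc_diff_le)
  then have "N \<le> 34 * K ^ 3 * (D + 1)"
    using cardE F by (metis le_trans mult_le_mono2)
  then have D1: "N \<le> 68 * K ^ 3 * D"
    using N by (simp add: algebra_simps)
  have "\<exists>x\<in>E. x div q = t" if "t \<in> F" for t
    using that by (auto simp: F_def)
  then obtain x y where xy: "x \<in> E" "y \<in> E" "x div q = Min F" "y div q = Max F"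
    using Min_in[of F] Max_in[of F] F(1,2) by metis
  have "x mod q = y mod q" and xyW: "(x div q) div W = (y div q) div W"
    using xy(1,2) by (auto simp: E_def c_def)
  have le: "x div q \<le> y div q"
    using F xy by simp
  have yx: "real y - real x = real q * real D"
  proof -
    have "y = q * (y div q) + y mod q" "x = q * (x div q) + x mod q"
      by simp_all
    then have "real y - real x = real (q * (y div q)) - real (q * (x div q))"
      using \<open>x mod q = y mod q\<close> by (metis add_diff_cancel_right of_nat_add)
    then show ?thesis
      using le xy by (simp add: D_def of_nat_diff algebra_simps)
  qed
  have DW: "D < W"
  proof -
    have "y div q < W * ((y div q) div W) + W"
      using dividend_less_times_div[of W "y div q"] W3 by linarith
    moreover have "W * ((x div q) div W) \<le> x div q"
      by (rule times_div_less_eq_dividend)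
    ultimately show ?thesis
      using le unfolding D_def xy(3,4)[symmetric] xyW by linarith
  qed
  have N1: "real N \<le> real N ^ m" and Npos: "real N > 0"
    using m N by (auto intro: self_le_power)
  have \<theta>D: "\<bar>\<theta>\<bar> * real D \<le> 1/4"
  proof -
    have "8 * K * D \<le> N"
      using W1 DW mult_le_mono2[of D W "8 * K"] by linarith
    from of_nat_mono[OF this, where 'a = real] have "8 * real K * real D \<le> real N"
      by simp
    then have "\<bar>\<theta>\<bar> * (8 * real K * real D) \<le> \<bar>\<theta>\<bar> * real N ^ m"
      using N1 by (intro mult_left_mono order_trans[OF _ N1]) simp_all
    then have "(\<bar>\<theta>\<bar> * real D) * (8 * real K) \<le> (1/4) * (8 * real K)"
      using \<theta> by (simp add: mult_ac)
    then show ?thesis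
      using K by simp
  qed
  \<comment> \<open>The nearest integer \<open>z\<close> must be \<open>a * D\<close>:
    \<open>\<gamma> * (y - x)\<close> lies within \<open>1/4\<close> of \<open>a * D\<close> and
    within less than \<open>1/2\<close> of \<open>z\<close>. Hence
    \<open>\<bar>\<theta>\<bar> * D\<close> itself is the small distance to an integer, and dividing
    by \<open>D\<close> gains the factor \<open>N\<close>.\<close>
  obtain z :: int where z: "\<bar>\<gamma> * (real y - real x) - of_int z\<bar> = int_dist (\<gamma> * (real y - real x))"
    by (rule int_dist_obtain)
  have split: "\<gamma> * (real y - real x) = \<theta> * real D + of_int (a * int D)"
    unfolding yx \<theta>_def by (simp add: algebra_simps)
  have less_half: "int_dist (\<gamma> * (real y - real x)) < 1/2"
  proof -
    have "8 * K < N"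
      using N K3 by linarith
    then have "real (8 * K) < real N"
      by (simp only: of_nat_less_iff)
    then have "(2 * real K) * 4 < real N ^ m"
      by (intro less_le_trans[OF _ N1]) simp
    moreover have "int_dist (\<gamma> * (real y - real x)) * real N ^ m \<le> 2 * real K"
      using diff_small xy EH by blast
    ultimately have "int_dist (\<gamma> * (real y - real x)) * real N ^ m < (1/2) * real N ^ m"
      by linarith
    then show ?thesis
      by (rule mult_right_less_imp_less) simp
  qed
  have "\<bar>\<theta> * real D\<bar> \<le> 1/4"
    using \<theta>D by (simp add: abs_mult)
  moreover have "of_int (z - a * int D) = \<theta> * real D - (\<gamma> * (real y - real x) - of_int z)"
    using split by simp
  ultimately have "\<bar>of_int (z - a * int D) :: real\<bar> < 1"
    using z less_half by linarith
  then have "z = a * int D"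
    by linarith
  then have "\<bar>\<theta>\<bar> * real D = int_dist (\<gamma> * (real y - real x))"
    using z unfolding split by (simp add: abs_mult)
  then have \<theta>D': "\<bar>\<theta>\<bar> * real D * real N ^ m \<le> 2 * real K"
    using diff_small[of x y] xy EH by auto
  have "int_dist (real q * \<gamma>) * real N ^ Suc m = \<bar>\<theta>\<bar> * real N ^ m * real N"
    using a by (simp add: \<theta>_def)
  also have "\<dots> \<le> \<bar>\<theta>\<bar> * real N ^ m * (68 * real K ^ 3 * real D)"
    using of_nat_mono[OF D1, where 'a = real] by (intro mult_left_mono) auto
  also have "\<dots> = 68 * real K ^ 3 * (\<bar>\<theta>\<bar> * real D * real N ^ m)"
    by simp
  also have "\<dots> \<le> 68 * real K ^ 3 * (2 * real K)"
    using \<theta>D' by (intro mult_left_mono) auto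
  also have "\<dots> \<le> 2 ^ 8 * real K ^ 4"
    by (simp add: power4_eq_xxxx power3_eq_cube)
  also have "\<dots> \<le> real K ^ 8 * real K ^ 4"
    using K by (intro mult_right_mono power_mono) auto
  also have "\<dots> \<le> real K ^ (12 * Suc m)"
    using K unfolding power_add[symmetric] by (intro power_increasing) auto
  finally have "int_dist (real q * \<gamma>) * real N ^ Suc m \<le> real K ^ (12 * Suc m)" .
  moreover have "q \<le> K ^ (12 * Suc m)"
  proof -
    have "q \<le> K ^ 2"
      using q mult_le_mono1[OF K, of K] unfolding power2_eq_square by linarith
    also have "\<dots> \<le> K ^ (12 * Suc m)"
      using K by (intro power_increasing) auto
    finally show ?thesis .
  qed
  ultimately show ?thesis
    using q by blast
qed

text \<open>Differencing yields many shifts \<open>h\<close> with a large sum of degree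
  \<open>k\<close>. For each, the hypothesis on degree \<open>k\<close> brings a bounded multiple of
  \<open>(k + 1) * b (k + 1) * h\<close> close to an integer. Pigeonholing makes the multiplier
  independent of \<open>h\<close>, and \<open>int_dist_gain\<close> then removes \<open>h\<close>
  and improves \<open>N ^ k\<close> to \<open>N ^ (k + 1)\<close>.\<close>

lemma leading_coefficient:
  assumes W: "weyl_inverse k A" and k: "k \<ge> 1"
  shows "\<exists>A'. \<forall>b N K. K \<ge> 2 \<longrightarrow> real N \<le> real K * norm (\<Sum>x=1..N. e (polyfun (Suc k) b (real x))) \<longrightarrow>
    (\<exists>q\<ge>1. q \<le> K ^ A' \<and> int_dist (real q * b (Suc k)) * real N ^ Suc k \<le> real K ^ A')"
proof -
  define A' where "A' = 4 * (A + k + 1) * (12 * Suc k) + 4 * A + Suc k"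
  have "\<exists>q\<ge>1. q \<le> K ^ A' \<and> int_dist (real q * b (Suc k)) * real N ^ Suc k \<le> real K ^ A'"
    if K: "K \<ge> 2" and S: "real N \<le> real K * norm (\<Sum>x=1..N. e (polyfun (Suc k) b (real x)))" and N: "N > 0"
    for b and N K :: nat
  proof -
    define f where "f = polyfun (Suc k) b"
    define b' where "b' h j = affine_coeffs (Suc k) b 1 (real h) j - b j" for h j
    have b': "f (real (x + h)) - f (real x) = polyfun k (b' h) (real x)" for x h
    proof -
      have "f (real (x + h)) = polyfun (Suc k) (affine_coeffs (Suc k) b 1 (real h)) (real x)"
        unfolding f_def using polyfun_affine[of "Suc k" b 1 "real x" "real h"] by simp
      then have "f (real (x + h)) - f (real x) = polyfun (Suc k) (b' h) (real x)"
        unfolding f_def polyfun_def b'_def by (simp add: sum_subtractf left_diff_distrib)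
      also have "b' h (Suc k) = 0"
        by (simp add: b'_def affine_coeffs_shift_top)
      then have "polyfun (Suc k) (b' h) (real x) = polyfun k (b' h) (real x)"
        by (simp add: polyfun_Suc)
      finally show ?thesis .
    qed
    define T where "T h = norm (\<Sum>x=1..N-h. e (polyfun k (b' h) (real x)))" for h
    have T_le: "T h \<le> real (N - h)" for h
      unfolding T_def by (rule order_trans[OF norm_sum]) simp
    \<comment> \<open>The constants \<open>K\<^sup>2\<close> and 2 from squaring and differencing
      make up \<open>M / 2\<close>. Shifts outside \<open>H\<close> contribute at most
      \<open>N / M\<close> each, so they account for at most half of
      \<open>N\<^sup>2\<close>.\<close>
    define M where "M = 4 * K\<^sup>2"
    have M2: "M \<ge> 2" and M0: "real M > 0"
      using K unfolding M_def power2_eq_square by (simp_all add: Suc_leI)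
    have MK: "M \<le> K ^ 4"
      using power_mono[of 2 K 2] K mult_right_mono[of 4 "K\<^sup>2" "K\<^sup>2"] unfolding M_def
      by (simp flip: power_add)
    define H where "H = {h\<in>{..<N}. real N \<le> real M * T h}"
    have finH: "finite H"
      by (simp add: H_def)
    have "(real N)\<^sup>2 \<le> (real K)\<^sup>2 * (norm (\<Sum>x=1..N. e (f (real x))))\<^sup>2"
      using power_mono[OF S, of 2] by (simp add: power_mult_distrib f_def)
    also have "\<dots> \<le> (real K)\<^sup>2 * (2 * (\<Sum>h<N. T h))"
      using van_der_corput[of "\<lambda>x. f (real x)" N] by (intro mult_left_mono) (simp_all only: b' T_def zero_le_power2)
    also have "\<dots> = real M / 2 * (\<Sum>h<N. T h)"
      by (simp add: M_def)
    also have "(\<Sum>h<N. T h) \<le> (\<Sum>h<N. (if h \<in> H then real N else 0) + real N / real M)"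
    proof (rule sum_mono)
      fix h assume "h \<in> {..<N}"
      show "T h \<le> (if h \<in> H then real N else 0) + real N / real M"
      proof (cases "h \<in> H")
        case True
        have "T h \<le> real N"
          using T_le[of h] by simp
        then show ?thesis
          using True M0 by (simp add: add_increasing2)
      next
        case False
        then show ?thesis
          using \<open>h \<in> {..<N}\<close> M0 by (simp add: H_def field_simps)
      qed
    qed
    also have "\<dots> = real N * real (card H) + real N * real N / real M"
    proof -
      have "{..<N} \<inter> H = H"
        by (auto simp: H_def)
      then show ?thesis
        by (simp add: sum.distrib flip: sum.inter_restrict)
    qed
    also have "real M / 2 * \<dots> = real N * (real M * real (card H)) / 2 + (real N)\<^sup>2 / 2"
      using M0 by (simp add: field_simps power2_eq_square)
    finally have "real N * real N \<le> real N * (real M * real (card H))"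
      using M0 by (simp add: power2_eq_square)
    then have cardH: "N \<le> M * card H"
      using N by (simp flip: of_nat_mult)
    have "\<exists>q\<ge>1. q \<le> M ^ A \<and> int_dist (real q * (real (Suc k) * b (Suc k) * real h)) * real N ^ k \<le> real M ^ (A + k)"
      if "h \<in> H" for h
    proof -
      have NT: "real N \<le> real M * T h"
        using that by (simp add: H_def)
      have "real (N - h) \<le> real M * T h"
        using NT by simp
      then obtain q where q: "q \<ge> 1" "q \<le> M ^ A"
          "int_dist (real q * b' h k) * real (N - h) ^ k \<le> real M ^ A"
        using W M2 k unfolding weyl_inverse_def T_def by (metis atLeastAtMost_iff order_refl)
      \<comment> \<open>A large differenced sum cannot be short: \<open>h \<in> H\<close> forces
        \<open>N - h\<close> to be comparable to \<open>N\<close>, so the length can be restored at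
        the cost of \<open>M ^ k\<close>.\<close>
      have "real N \<le> real M * real (N - h)"
        using NT T_le[of h] M0 by (smt (verit) mult_left_mono)
      then have "int_dist (real q * b' h k) * real N ^ k \<le> int_dist (real q * b' h k) * (real M * real (N - h)) ^ k"
        by (intro mult_left_mono power_mono) auto
      also have "\<dots> = real M ^ k * (int_dist (real q * b' h k) * real (N - h) ^ k)"
        by (simp add: power_mult_distrib mult_ac)
      also have "\<dots> \<le> real M ^ k * real M ^ A"
        using q by (intro mult_left_mono) auto
      finally show ?thesis
        using q by (auto simp: b'_def affine_coeffs_shift_second power_add mult_ac)
    qed
    then obtain qf where qf: "\<And>h. h \<in> H \<Longrightarrow> qf h \<ge> 1 \<and> qf h \<le> M ^ A \<and>
        int_dist (real (qf h) * (real (Suc k) * b (Suc k) * real h)) * real N ^ k \<le> real M ^ (A + k)"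
      by metis
    \<comment> \<open>Only \<open>M ^ A\<close> denominators occur, so one of them serves a
      proportion \<open>1 / M ^ A\<close> of the shifts.\<close>
    have "\<exists>q\<in>{1..M ^ A}. card (qf -` {q} \<inter> H) * card {1..M ^ A} \<ge> card H"
      using qf finH M2 by (intro pigeonhole_card) (auto simp: Suc_le_eq)
    then obtain q where q: "q \<ge> 1" "q \<le> M ^ A" "card (qf -` {q} \<inter> H) * M ^ A \<ge> card H"
      by auto
    define G where "G = qf -` {q} \<inter> H"
    define \<gamma> where "\<gamma> = real (q * Suc k) * b (Suc k)"
    \<comment> \<open>One parameter dominating both the density loss \<open>M ^ (A + 1)\<close> and
      the distance bound \<open>M ^ (A + k)\<close>, as \<open>int_dist_gain\<close> uses a single
      constant for the two.\<close>
    define R where "R = M ^ (A + k + 1)"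
    have "M ^ 1 \<le> R"
      unfolding R_def using M2 by (intro power_increasing) auto
    then have R2: "R \<ge> 2"
      using M2 by simp
    have "N \<le> M * (card G * M ^ A)"
      using cardH q(3) unfolding G_def by (meson le_trans mult_le_mono2)
    also have "\<dots> = M ^ (A + 1) * card G"
      by simp
    also have "\<dots> \<le> R * card G"
      unfolding R_def using M2 by (intro mult_right_mono power_increasing) auto
    finally have GN: "N \<le> R * card G" .
    have "\<exists>q'\<ge>1. q' \<le> R ^ (12 * Suc k) \<and> int_dist (real q' * \<gamma>) * real N ^ Suc k \<le> real R ^ (12 * Suc k)"
    proof (rule int_dist_gain[OF R2 k _ GN])
      show "G \<subseteq> {..<N}"
        by (auto simp: G_def H_def)
      fix h assume "h \<in> G"
      then have h: "h \<in> H" "qf h = q"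
        by (auto simp: G_def)
      have "int_dist (\<gamma> * real h) * real N ^ k \<le> real M ^ (A + k)"
        using qf[OF h(1)] by (simp only: \<gamma>_def h(2) of_nat_mult mult.assoc)
      also have "\<dots> \<le> real R"
        unfolding R_def of_nat_power using M2 by (intro power_increasing) auto
      finally show "int_dist (\<gamma> * real h) * real N ^ k \<le> real R" .
    qed
    then obtain q' where q': "q' \<ge> 1" "q' \<le> R ^ (12 * Suc k)"
        "int_dist (real q' * \<gamma>) * real N ^ Suc k \<le> real R ^ (12 * Suc k)"
      by blast
    have R_le: "R ^ (12 * Suc k) \<le> K ^ (4 * (A + k + 1) * (12 * Suc k))"
      unfolding R_def power_mult[of K] using MK by (intro power_mono) auto
    have "Suc k \<le> 2 ^ Suc k"
      using less_exp[of "Suc k"] by (rule less_imp_le)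
    also have "\<dots> \<le> K ^ Suc k"
      using K by (intro power_mono) auto
    finally have Suc_k_le: "Suc k \<le> K ^ Suc k" .
    have "M ^ A \<le> K ^ (4 * A)"
      unfolding power_mult using MK by (intro power_mono) auto
    then have "q' * (q * Suc k) \<le> K ^ (4 * (A + k + 1) * (12 * Suc k)) * (K ^ (4 * A) * K ^ Suc k)"
      using q'(2) R_le q(2) Suc_k_le by (intro mult_le_mono) auto
    then have "q' * (q * Suc k) \<le> K ^ A'"
      by (simp only: A'_def power_add mult.assoc)
    moreover have "int_dist (real (q' * (q * Suc k)) * b (Suc k)) * real N ^ Suc k \<le> real K ^ A'"
    proof -
      have "int_dist (real (q' * (q * Suc k)) * b (Suc k)) * real N ^ Suc k \<le> real R ^ (12 * Suc k)"
        using q'(3) by (simp only: \<gamma>_def of_nat_mult mult.assoc)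
      also have "\<dots> \<le> real K ^ (4 * (A + k + 1) * (12 * Suc k))"
        using R_le by (simp flip: of_nat_power)
      also have "\<dots> \<le> real K ^ A'"
        using K by (intro power_increasing) (auto simp: A'_def)
      finally show ?thesis .
    qed
    moreover have "q' * (q * Suc k) \<ge> 1"
      using q q' by simp
    ultimately show ?thesis
      by blast
  qed
  \<comment> \<open>The empty sum is treated apart, because a factor \<open>N\<close> was cancelled
    above.\<close>
  moreover have "\<exists>q\<ge>1. q \<le> K ^ A' \<and> int_dist (real q * b (Suc k)) * real 0 ^ Suc k \<le> real K ^ A'"
    if "K \<ge> 2" for b and K :: nat
    using that by (intro exI[of _ 1]) auto
  ultimately show ?thesis
    by (metis gr0I)
qed

section \<open>Restriction to arithmetic progressions\<close>

lemma sum_shift_bound: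
  fixes f :: "nat \<Rightarrow> complex"
  assumes "\<And>x. norm (f x) \<le> 1"
  shows "norm ((\<Sum>x=1..N. f (x + t)) - (\<Sum>x=1..N. f x)) \<le> 2 * real t"
proof (induction t)
  case (Suc t)
  \<comment> \<open>One further unit shift gains a term at the end and loses one at the start, a
    change of at most 2.\<close>
  have *: "(\<Sum>x=1..N. f (x + Suc t)) = (\<Sum>x=1..N. f (x + t)) + (f (Suc N + t) - f (Suc t))"
    by (induction N) simp_all
  have "(\<Sum>x=1..N. f (x + Suc t)) - (\<Sum>x=1..N. f x) =
      ((\<Sum>x=1..N. f (x + t)) - (\<Sum>x=1..N. f x)) + (f (Suc N + t) - f (Suc t))"
    unfolding * by (rule diff_add_eq[symmetric])
  then have "norm ((\<Sum>x=1..N. f (x + Suc t)) - (\<Sum>x=1..N. f x)) \<le>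
      norm ((\<Sum>x=1..N. f (x + t)) - (\<Sum>x=1..N. f x)) + norm (f (Suc N + t) - f (Suc t))"
    by (simp only: norm_triangle_ineq)
  moreover have "norm (f (Suc N + t) - f (Suc t)) \<le> 1 + 1"
    by (rule order_trans[OF norm_triangle_ineq4]) (intro add_mono assms)
  ultimately show ?case
    using Suc.IH by simp
qed simp

text \<open>Average the sum over its shifts by \<open>q * y\<close> with \<open>y \<le> L\<close>.
  Each shift changes it by at most \<open>2 * q * L\<close>, and
  \<open>4 * q * L * K \<le> N\<close> keeps the total change within half of the assumed size. If
  all progression sums were small, the average would be too small.\<close>

lemma large_sum_progression:
  fixes f :: "nat \<Rightarrow> complex"
  assumes f: "\<And>x. norm (f x) \<le> 1" and N: "N > 0" and L: "L > 0" "4 * q * L * K \<le> N"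
    and S: "real N \<le> real K * norm (\<Sum>x=1..N. f x)"
  shows "\<exists>s\<in>{1..N}. real L \<le> 2 * real K * norm (\<Sum>y=1..L. f (s + q * y))"
proof (rule ccontr)
  assume "\<not> ?thesis"
  then have less: "2 * real K * norm (\<Sum>y=1..L. f (s + q * y)) < real L" if "s \<in> {1..N}" for s
    using that by (meson not_le)
  define S0 where "S0 = (\<Sum>x=1..N. f x)"
  have "real L * norm S0 = norm (\<Sum>y=1..L. S0)"
    by (simp add: norm_mult)
  also have "(\<Sum>y=1..L. S0) = (\<Sum>y=1..L. \<Sum>x=1..N. f (x + q * y)) - (\<Sum>y=1..L. (\<Sum>x=1..N. f (x + q * y)) - S0)"
    by (simp add: sum_subtractf)
  also have "norm \<dots> \<le> norm (\<Sum>y=1..L. \<Sum>x=1..N. f (x + q * y)) + norm (\<Sum>y=1..L. (\<Sum>x=1..N. f (x + q * y)) - S0)"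
    by (rule norm_triangle_ineq4)
  also have "(\<Sum>y=1..L. \<Sum>x=1..N. f (x + q * y)) = (\<Sum>x=1..N. \<Sum>y=1..L. f (x + q * y))"
    by (rule sum.swap)
  also have "norm \<dots> \<le> (\<Sum>x=1..N. norm (\<Sum>y=1..L. f (x + q * y)))"
    by (rule norm_sum)
  also have "norm (\<Sum>y=1..L. (\<Sum>x=1..N. f (x + q * y)) - S0) \<le> real (card {1..L}) * (2 * real (q * L))"
  proof (rule order_trans[OF norm_sum sum_bounded_above])
    fix y assume "y \<in> {1..L}"
    then have "real (q * y) \<le> real (q * L)"
      by (intro of_nat_mono mult_le_mono2) simp
    then show "norm ((\<Sum>x=1..N. f (x + q * y)) - S0) \<le> 2 * real (q * L)"
      using sum_shift_bound[where f = f and N = N and t = "q * y", OF f] unfolding S0_def by linarith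
  qed
  finally have "real L * norm S0 \<le> (\<Sum>x=1..N. norm (\<Sum>y=1..L. f (x + q * y))) + real L * (2 * real (q * L))"
    by simp
  then have "2 * real K * (real L * norm S0) \<le>
      2 * real K * ((\<Sum>x=1..N. norm (\<Sum>y=1..L. f (x + q * y))) + real L * (2 * real (q * L)))"
    by (rule mult_left_mono) simp
  also have "\<dots> = (\<Sum>x=1..N. 2 * real K * norm (\<Sum>y=1..L. f (x + q * y))) + real L * real (4 * q * L * K)"
    unfolding sum_distrib_left[symmetric] by (simp add: algebra_simps)
  also have "\<dots> < (\<Sum>x=1..N. real L) + real L * real N"
  proof (rule add_less_le_mono)
    show "(\<Sum>x=1..N. 2 * real K * norm (\<Sum>y=1..L. f (x + q * y))) < (\<Sum>x=1..N. real L)"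
      using N by (intro sum_strict_mono less) auto
    show "real L * real (4 * q * L * K) \<le> real L * real N"
      by (rule mult_left_mono[OF of_nat_mono[OF L(2)]]) simp
  qed
  also have "\<dots> = 2 * (real L * real N)"
    by simp
  also have "\<dots> \<le> 2 * (real L * (real K * norm S0))"
    using S unfolding S0_def[symmetric] by (intro mult_left_mono) auto
  finally show False
    by (simp only: mult_ac less_irrefl)
qed

text \<open>The quotient is an integer, so with \<open>t = q * y\<close> an integer approximating
  \<open>q * b (k + 1)\<close> contributes only an integer to the phase.\<close>

lemma power_add_quotient:
  fixes s t :: nat
  shows "\<exists>D. (s + t) ^ Suc k = s ^ Suc k + t * D \<and> D \<le> Suc k * (s + t) ^ k"
proof (induction k)
  case (Suc k)
  then obtain D where D: "(s + t) ^ Suc k = s ^ Suc k + t * D" "D \<le> Suc k * (s + t) ^ k"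
    by blast
  have "(s + t) ^ Suc (Suc k) = (s + t) * (s ^ Suc k + t * D)"
    using D(1) by simp
  also have "\<dots> = s ^ Suc (Suc k) + t * (s ^ Suc k + (s + t) * D)"
    by (simp add: algebra_simps)
  finally have "(s + t) ^ Suc (Suc k) = s ^ Suc (Suc k) + t * (s ^ Suc k + (s + t) * D)" .
  moreover have "s ^ Suc k + (s + t) * D \<le> (s + t) ^ Suc k + (s + t) * (Suc k * (s + t) ^ k)"
    using D(2) by (intro add_mono power_mono mult_left_mono) auto
  then have "s ^ Suc k + (s + t) * D \<le> Suc (Suc k) * (s + t) ^ Suc k"
    by (simp add: algebra_simps)
  ultimately show ?case
    by blast
qed (auto intro!: exI[of _ 1])

text \<open>Inverting the substitution expresses \<open>b j\<close> through the
  \<open>\<gamma> i\<close> with \<open>i \<ge> j\<close>, and \<open>q ^ k\<close> clears all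
  denominators. The factor \<open>N ^ (i - j)\<close> coming from \<open>s \<le> N\<close> joins
  \<open>N ^ j\<close> to form \<open>N ^ i\<close>, which matches the decay
  \<open>1 / L ^ i\<close> of the \<open>i\<close>-th distance up to \<open>M ^ k\<close>.\<close>

lemma int_dist_coeffs_affine:
  fixes b :: "nat \<Rightarrow> real" and k q s r L N M :: nat
  defines "\<gamma> \<equiv> affine_coeffs k b (real q) (real s)"
  assumes q: "q \<ge> 1" and s: "s \<le> N" and M: "M \<ge> 1" "N \<le> M * L"
    and \<gamma>: "\<And>i. i \<in> {1..k} \<Longrightarrow> int_dist (real r * \<gamma> i) * real L ^ i \<le> B"
    and j: "j \<in> {1..k}"
  shows "int_dist (real (r * q ^ k) * b j) * real N ^ j \<le> real (Suc k * 2 ^ k * q ^ k * M ^ k) * B"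
proof -
  \<comment> \<open>The integer factor of \<open>r * \<gamma> i\<close> in
    \<open>r * q ^ k * b j\<close>: the powers of \<open>1 / q\<close> total \<open>i\<close>,
    leaving \<open>q ^ (k - i)\<close>.\<close>
  define c :: "nat \<Rightarrow> int" where "c i = int (i choose j) * (- int s) ^ (i - j) * int q ^ (k - i)" for i
  have "b j = (\<Sum>i\<le>k. \<gamma> i * real (i choose j) * (1 / real q) ^ j * (- real s / real q) ^ (i - j))"
    using affine_coeffs_inverse[of "real q" j k b "real s"] q j by (simp add: \<gamma>_def affine_coeffs_def)
  also have "\<dots> = (\<Sum>i\<in>{j..k}. \<gamma> i * real (i choose j) * (1 / real q) ^ j * (- real s / real q) ^ (i - j))"
    by (intro sum.mono_neutral_right) (auto simp: binomial_eq_0)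
  finally have "real (r * q ^ k) * b j =
      (\<Sum>i\<in>{j..k}. real (r * q ^ k) * (\<gamma> i * real (i choose j) * (1 / real q) ^ j * (- real s / real q) ^ (i - j)))"
    by (simp add: sum_distrib_left)
  also have "\<dots> = (\<Sum>i\<in>{j..k}. of_int (c i) * (real r * \<gamma> i))"
  proof (rule sum.cong)
    fix i assume i: "i \<in> {j..k}"
    have *: "real q ^ k = real q ^ (k - i) * (real q ^ j * real q ^ (i - j))"
      using i by (simp flip: power_add)
    have "real q ^ k * ((1 / real q) ^ j * (- real s / real q) ^ (i - j)) = real q ^ (k - i) * (- real s) ^ (i - j)"
      unfolding * power_divide using q by simp
    then show "real (r * q ^ k) * (\<gamma> i * real (i choose j) * (1 / real q) ^ j * (- real s / real q) ^ (i - j)) =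
        of_int (c i) * (real r * \<gamma> i)"
      by (simp add: c_def algebra_simps)
  qed simp
  finally have "int_dist (real (r * q ^ k) * b j) * real N ^ j \<le>
      (\<Sum>i\<in>{j..k}. \<bar>of_int (c i)\<bar> * int_dist (real r * \<gamma> i)) * real N ^ j"
    by (intro mult_right_mono order_trans[OF _ sum_mono[OF int_dist_mult_int]]) (auto simp: int_dist_sum)
  also have "\<dots> = (\<Sum>i\<in>{j..k}. \<bar>of_int (c i)\<bar> * int_dist (real r * \<gamma> i) * real N ^ j)"
    by (simp add: sum_distrib_right)
  also have "\<dots> \<le> (\<Sum>i\<in>{j..k}. 2 ^ k * real q ^ k * real M ^ k * B)"
  proof (rule sum_mono)
    fix i assume i: "i \<in> {j..k}"
    have "real N ^ i \<le> (real M * real L) ^ i"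
      using M by (intro power_mono) (auto simp flip: of_nat_mult)
    also have "\<dots> = real M ^ i * real L ^ i"
      by (rule power_mult_distrib)
    also have "\<dots> \<le> real M ^ k * real L ^ i"
      using M i by (intro mult_right_mono power_increasing) auto
    finally have N_le: "real N ^ i \<le> real M ^ k * real L ^ i" .
    have "\<bar>of_int (c i)\<bar> = real (i choose j) * real s ^ (i - j) * real q ^ (k - i)"
      by (simp add: c_def abs_mult power_abs)
    also have "\<dots> \<le> 2 ^ k * real N ^ (i - j) * real q ^ k"
    proof (intro mult_mono power_mono power_increasing)
      have "i choose j \<le> 2 ^ i"
        by (rule binomial_le_pow2)
      also have "\<dots> \<le> 2 ^ k"
        using i by (intro power_increasing) auto
      finally show "real (i choose j) \<le> 2 ^ k"
        by (metis of_nat_le_iff of_nat_numeral of_nat_power)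
    qed (use q s in auto)
    finally have "\<bar>of_int (c i)\<bar> * int_dist (real r * \<gamma> i) * real N ^ j \<le>
        (2 ^ k * real N ^ (i - j) * real q ^ k) * int_dist (real r * \<gamma> i) * real N ^ j"
      by (intro mult_right_mono) auto
    also have "\<dots> = 2 ^ k * real q ^ k * (int_dist (real r * \<gamma> i) * (real N ^ (i - j) * real N ^ j))"
      by (simp only: mult_ac)
    also have "real N ^ (i - j) * real N ^ j = real N ^ i"
      using i by (simp flip: power_add)
    also have "2 ^ k * real q ^ k * (int_dist (real r * \<gamma> i) * real N ^ i) \<le>
        2 ^ k * real q ^ k * (int_dist (real r * \<gamma> i) * (real M ^ k * real L ^ i))"
      using N_le by (intro mult_left_mono) auto
    also have "\<dots> = 2 ^ k * real q ^ k * real M ^ k * (int_dist (real r * \<gamma> i) * real L ^ i)"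
      by (simp only: mult_ac)
    also have "\<dots> \<le> 2 ^ k * real q ^ k * real M ^ k * B"
      using i j by (intro mult_left_mono \<gamma>) auto
    finally show "\<bar>of_int (c i)\<bar> * int_dist (real r * \<gamma> i) * real N ^ j \<le> 2 ^ k * real q ^ k * real M ^ k * B" .
  qed
  also have "\<dots> \<le> real (Suc k) * (2 ^ k * real q ^ k * real M ^ k * B)"
  proof -
    \<comment> \<open>Since \<open>B \<ge> 0\<close>, the number of summands may be rounded up to
      \<open>k + 1\<close>.\<close>
    have "0 \<le> int_dist (real r * \<gamma> j) * real L ^ j"
      by simp
    also have "\<dots> \<le> B"
      by (rule \<gamma>[OF j])
    finally have "B \<ge> 0" .
    then show ?thesis
      by (simp add: mult_right_mono)
  qed
  finally show ?thesis
    by (simp only: of_nat_mult of_nat_power of_nat_numeral mult_ac)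
qed

text \<open>The leading coefficient yields \<open>q\<close>. On a suitable progression
  \<open>s + q * y\<close> with \<open>y \<le> L\<close> the top term is constant modulo 1 up to a
  small error, so the hypothesis on degree \<open>k\<close> yields a further denominator
  \<open>r\<close>. The common denominator is \<open>r * q ^ k\<close>.\<close>

lemma weyl_inverse_Suc:
  assumes W: "weyl_inverse k A" and k: "k \<ge> 1"
  shows "\<exists>A'. weyl_inverse (Suc k) A'"
proof -
  obtain c where c: "\<And>b N K. K \<ge> 2 \<Longrightarrow> real N \<le> real K * norm (\<Sum>x=1..N. e (polyfun (Suc k) b (real x))) \<Longrightarrow>
      \<exists>q\<ge>1. q \<le> K ^ c \<and> int_dist (real q * b (Suc k)) * real N ^ Suc k \<le> real K ^ c"
    using leading_coefficient[OF assms] by metis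
  \<comment> \<open>Exactly the losses in the bound for the top term's variation:
    \<open>K ^ 5\<close> for 32, one \<open>K\<close> for the target precision,
    \<open>K ^ (k + 1)\<close> for the factor \<open>k + 1\<close>, \<open>K ^ k\<close> for
    \<open>2 ^ k\<close>, and \<open>K ^ c\<close> from the leading coefficient.\<close>
  define c' where "c' = c + 2 * k + 7"
  \<comment> \<open>The first summand serves the case of small \<open>N\<close>; the bracket
    collects the losses of the lower coefficients, with
    \<open>(4 * K) ^ A \<le> K ^ (3 * A)\<close>.\<close>
  define A' where "A' = c' * Suc k + (Suc k + k + c * k + (c' + 1) * k + 3 * A)"
  have "\<exists>q\<ge>1. q \<le> K ^ A' \<and> (\<forall>j\<in>{1..Suc k}. int_dist (real q * b j) * real N ^ j \<le> real K ^ A')"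
    if K: "K \<ge> 2" and S: "real N \<le> real K * norm (\<Sum>x=1..N. e (polyfun (Suc k) b (real x)))" for b and N K :: nat
  proof (cases "N < K ^ c'")
    case True
    have "int_dist (real 1 * b j) * real N ^ j \<le> real K ^ A'" if j: "j \<in> {1..Suc k}" for j
    proof -
      have "int_dist (real 1 * b j) * real N ^ j \<le> 1 * (real K ^ c') ^ j"
        using True int_dist_le_half[of "b j"] by (intro mult_mono power_mono) (auto simp flip: of_nat_power)
      also have "\<dots> \<le> real K ^ (c' * Suc k)"
        using K j unfolding mult_1 power_mult[symmetric] by (intro power_increasing mult_le_mono2) auto
      also have "\<dots> \<le> real K ^ A'"
        using K by (intro power_increasing) (auto simp: A'_def)
      finally show ?thesis .
    qed
    then show ?thesis
      using K by (intro exI[of _ 1]) auto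
  next
    case False
    obtain q where q: "q \<ge> 1" "q \<le> K ^ c" "int_dist (real q * b (Suc k)) * real N ^ Suc k \<le> real K ^ c"
      using c[OF K S] by blast
    define L where "L = N div K ^ c'"
    have Kc': "K ^ c' > 0"
      using K by simp
    have L: "L > 0" "K ^ c' * L \<le> N" and NL: "N \<le> K ^ (c' + 1) * L"
    proof -
      show L0: "L > 0"
        unfolding L_def using False Kc' by (simp add: div_greater_zero_iff)
      show "K ^ c' * L \<le> N"
        unfolding L_def by (rule times_div_less_eq_dividend)
      have "N < K ^ c' + K ^ c' * L"
        unfolding L_def by (rule dividend_less_times_div[OF Kc'])
      also have "\<dots> \<le> K ^ c' * L + K ^ c' * L"
        using L0 by simp
      also have "\<dots> \<le> K ^ (c' + 1) * L"
        using mult_le_mono1[OF K, of "K ^ c' * L"] by (simp only: mult_2 distrib_left power_add power_one_right mult_ac)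
      finally show "N \<le> K ^ (c' + 1) * L"
        by simp
    qed
    have N: "N > 0"
      using False Kc' by linarith
    have "4 * q * L * K \<le> K ^ 2 * K ^ c * L * K"
      using power_mono[OF K, of 2] q(2) by (intro mult_le_mono) auto
    also have "\<dots> = K ^ (c + 3) * L"
      by (simp add: power_add eval_nat_numeral)
    also have "\<dots> \<le> K ^ c' * L"
      using K by (intro mult_le_mono1 power_increasing) (auto simp: c'_def)
    also have "\<dots> \<le> N"
      by (rule L(2))
    finally have "4 * q * L * K \<le> N" .
    then obtain s where s: "s \<in> {1..N}"
      and Ls: "real L \<le> 2 * real K * norm (\<Sum>y=1..L. e (polyfun (Suc k) b (real (s + q * y))))"
      using large_sum_progression[of "\<lambda>x. e (polyfun (Suc k) b (real x))" N L q K] N L S by auto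
    \<comment> \<open>Only the terms of degree at most \<open>k\<close> are re-expanded in
      \<open>y\<close>; the top term is split off and approximated by the constant factor
      \<open>w\<close>.\<close>
    define \<gamma> where "\<gamma> = affine_coeffs k b (real q) (real s)"
    define S' where "S' = (\<Sum>y=1..L. e (polyfun k \<gamma> (real y)))"
    obtain n :: int where n: "\<bar>real q * b (Suc k) - of_int n\<bar> = int_dist (real q * b (Suc k))"
      by (rule int_dist_obtain)
    define \<theta> where "\<theta> = real q * b (Suc k) - of_int n"
    define w where "w = e (b (Suc k) * real s ^ Suc k)"
    have close: "norm (e (polyfun (Suc k) b (real (s + q * y))) - w * e (polyfun k \<gamma> (real y))) \<le> 1 / (4 * real K)"
      if y: "y \<in> {1..L}" for y
    proof -
      obtain D where D: "(s + q * y) ^ Suc k = s ^ Suc k + q * y * D" "D \<le> Suc k * (s + q * y) ^ k"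
        using power_add_quotient by blast
      have "q * y \<le> N"
      proof -
        have "q * y \<le> K ^ c * L"
          using q(2) y by (intro mult_le_mono) auto
        also have "\<dots> \<le> K ^ c' * L"
          using K by (intro mult_le_mono1 power_increasing) (auto simp: c'_def)
        also have "\<dots> \<le> N"
          by (rule L(2))
        finally show ?thesis .
      qed
      have D_le: "D \<le> Suc k * (2 * N) ^ k"
        using s \<open>q * y \<le> N\<close> by (intro order_trans[OF D(2)] mult_le_mono2 power_mono) auto
      have "b (Suc k) * real (s + q * y) ^ Suc k = b (Suc k) * real ((s + q * y) ^ Suc k)"
        by simp
      also have "\<dots> = b (Suc k) * real s ^ Suc k + (real q * b (Suc k)) * real (y * D)"
        unfolding D(1) by (simp add: algebra_simps)
      \<comment> \<open>The integer part \<open>n * y * D\<close> disappears inside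
        \<open>e\<close>, leaving the phase error \<open>\<theta> * y * D\<close>.\<close>
      also have "real q * b (Suc k) = of_int n + \<theta>"
        by (simp add: \<theta>_def)
      also have "b (Suc k) * real s ^ Suc k + (of_int n + \<theta>) * real (y * D) =
          b (Suc k) * real s ^ Suc k + \<theta> * real (y * D) + of_int (n * int (y * D))"
        by (simp add: algebra_simps)
      finally have "e (polyfun (Suc k) b (real (s + q * y))) = e (polyfun k b (real (s + q * y))) * w * e (\<theta> * real (y * D))"
        by (simp only: polyfun_Suc e_add e_of_int w_def mult.assoc mult_1_right)
      also have "polyfun k b (real (s + q * y)) = polyfun k \<gamma> (real y)"
        using polyfun_affine[of k b "real q" "real y" "real s"] by (simp add: \<gamma>_def add.commute)
      finally have "e (polyfun (Suc k) b (real (s + q * y))) - w * e (polyfun k \<gamma> (real y)) =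
          e (polyfun k \<gamma> (real y)) * w * (e (\<theta> * real (y * D)) - 1)"
        by (simp add: algebra_simps)
      then have "norm (e (polyfun (Suc k) b (real (s + q * y))) - w * e (polyfun k \<gamma> (real y))) =
          norm (e (\<theta> * real (y * D)) - 1)"
        by (simp add: norm_mult w_def)
      also have "\<dots> \<le> 8 * \<bar>\<theta> * real (y * D)\<bar>"
        by (rule norm_e_minus_1_le)
      also have "\<dots> = 8 * \<bar>\<theta>\<bar> * real (y * D)"
        by (simp add: abs_mult)
      finally have 1: "norm (e (polyfun (Suc k) b (real (s + q * y))) - w * e (polyfun k \<gamma> (real y))) \<le> 8 * \<bar>\<theta>\<bar> * real (y * D)" .
      have "y * D \<le> L * (Suc k * (2 * N) ^ k)"
        using y D_le by (intro mult_le_mono) auto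
      then have "32 * K * (y * D) * N \<le> 32 * K * (L * (Suc k * (2 * N) ^ k)) * N"
        by (intro mult_le_mono1 mult_le_mono2)
      also have "\<dots> = 2 ^ 5 * K * Suc k * 2 ^ k * L * N ^ Suc k"
        by (simp add: power_mult_distrib algebra_simps)
      also have "\<dots> \<le> K ^ 5 * K * K ^ Suc k * K ^ k * L * N ^ Suc k"
      proof -
        have "Suc k \<le> 2 ^ Suc k"
          using less_exp[of "Suc k"] by (rule less_imp_le)
        also have "\<dots> \<le> K ^ Suc k"
          using K by (intro power_mono) auto
        finally show ?thesis
          using K by (intro mult_le_mono power_mono) auto
      qed
      finally have 2: "real (32 * K * (y * D) * N) \<le> real (K ^ 5 * K * K ^ Suc k * K ^ k * L * N ^ Suc k)"
        by (rule of_nat_mono)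
      have "8 * \<bar>\<theta>\<bar> * real (y * D) * (4 * real K * real N) = \<bar>\<theta>\<bar> * real (32 * K * (y * D) * N)"
        by simp
      also have "\<dots> \<le> \<bar>\<theta>\<bar> * real (K ^ 5 * K * K ^ Suc k * K ^ k * L * N ^ Suc k)"
        using 2 by (intro mult_left_mono) auto
      also have "\<dots> = real (K ^ 5 * K * K ^ Suc k * K ^ k * L) * (\<bar>\<theta>\<bar> * real N ^ Suc k)"
        by (simp only: of_nat_mult of_nat_power mult_ac)
      also have "\<dots> \<le> real (K ^ 5 * K * K ^ Suc k * K ^ k * L) * real K ^ c"
        using q(3) n unfolding \<theta>_def by (intro mult_left_mono) auto
      also have "\<dots> = real (K ^ c' * L)"
      proof -
        have "c' = 5 + (1 + (Suc k + (k + c)))"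
          by (simp add: c'_def)
        then have "K ^ c' = K ^ 5 * (K * (K ^ Suc k * (K ^ k * K ^ c)))"
          by (simp only: power_add power_one_right)
        then show ?thesis
          by (simp only: of_nat_mult of_nat_power mult_ac)
      qed
      also have "\<dots> \<le> 1 * real N"
        using L(2) by (simp only: of_nat_le_iff mult_1)
      finally have "(8 * \<bar>\<theta>\<bar> * real (y * D) * (4 * real K)) * real N \<le> 1 * real N"
        by (simp only: mult_ac)
      then have "8 * \<bar>\<theta>\<bar> * real (y * D) * (4 * real K) \<le> 1"
        by (rule mult_right_le_imp_le) (use N in simp)
      then have "8 * \<bar>\<theta>\<bar> * real (y * D) \<le> 1 / (4 * real K)"
        using K by (subst pos_le_divide_eq) auto
      with 1 show ?thesis
        by linarith
    qed
    have "norm ((\<Sum>y=1..L. e (polyfun (Suc k) b (real (s + q * y)))) - w * S') \<le> real (card {1..L}) * (1 / (4 * real K))"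
      unfolding S'_def sum_distrib_left sum_subtractf[symmetric]
      by (rule order_trans[OF norm_sum sum_bounded_above[OF close]])
    then have "norm (\<Sum>y=1..L. e (polyfun (Suc k) b (real (s + q * y)))) \<le> norm (w * S') + real L / (4 * real K)"
      using norm_triangle_sub[of "\<Sum>y=1..L. e (polyfun (Suc k) b (real (s + q * y)))" "w * S'"] by simp
    then have "2 * real K * norm (\<Sum>y=1..L. e (polyfun (Suc k) b (real (s + q * y)))) \<le>
        2 * real K * (norm S' + real L / (4 * real K))"
      by (intro mult_left_mono) (simp_all add: norm_mult w_def)
    \<comment> \<open>The error of \<open>1 / (4 * K)\<close> per term consumes exactly half of
      \<open>L\<close>; the loss turns \<open>2 * K\<close> into \<open>4 * K\<close> for the sum of
      degree \<open>k\<close>.\<close>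
    also have "\<dots> = 2 * real K * norm S' + real L / 2"
      using K by (simp add: field_simps)
    finally have "real L \<le> real (4 * K) * norm S'"
      using Ls by simp
    then obtain r where r: "r \<ge> 1" "r \<le> (4 * K) ^ A"
        "\<And>i. i \<in> {1..k} \<Longrightarrow> int_dist (real r * \<gamma> i) * real L ^ i \<le> real (4 * K) ^ A"
      using W K unfolding weyl_inverse_def S'_def
      by (metis mult_le_mono one_le_numeral nat_mult_1)
    have K4: "(4 * K) ^ A \<le> K ^ (3 * A)"
    proof -
      have "4 * K \<le> K ^ 2 * K"
        using power_mono[OF K, of 2] by (intro mult_le_mono1) simp
      then show ?thesis
        unfolding power_mult by (intro power_mono) (simp_all add: eval_nat_numeral)
    qed
    have r_le: "r * q ^ k \<le> K ^ (c * k + 3 * A)"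
    proof -
      have "r * q ^ k \<le> K ^ (3 * A) * (K ^ c) ^ k"
        using r(2) K4 q(2) by (intro mult_le_mono power_mono) auto
      then show ?thesis
        by (simp add: power_add power_mult mult.commute)
    qed
    have "int_dist (real (r * q ^ k) * b j) * real N ^ j \<le> real K ^ A'" if "j \<in> {1..Suc k}" for j
    proof (cases "j = Suc k")
      case True
      \<comment> \<open>One of the \<open>k\<close> factors \<open>q\<close> is kept next to
        \<open>b (k + 1)\<close>, where it makes the distance small; the others only enlarge it by a
        bounded power of \<open>K\<close>.\<close>
      obtain k' where k': "k = Suc k'"
        using k by (cases k) auto
      have "int_dist (real (r * q ^ k) * b j) = int_dist (real (r * q ^ k') * (real q * b (Suc k)))"
        by (simp add: True k' mult_ac)
      also have "\<dots> * real N ^ j \<le> real (r * q ^ k') * int_dist (real q * b (Suc k)) * real N ^ Suc k"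
        unfolding True by (intro mult_right_mono int_dist_mult_nat) simp
      also have "\<dots> \<le> real (r * q ^ k') * real K ^ c"
        unfolding mult.assoc using q(3) by (intro mult_left_mono) auto
      also have "\<dots> \<le> (real K ^ (3 * A) * (real K ^ c) ^ k') * real K ^ c"
      proof -
        have "r * q ^ k' \<le> K ^ (3 * A) * (K ^ c) ^ k'"
          using r(2) K4 q(2) by (intro mult_le_mono power_mono) auto
        from of_nat_mono[OF this, where 'a = real] show ?thesis
          by (intro mult_right_mono) auto
      qed
      also have "\<dots> = real K ^ (c * k + 3 * A)"
        by (simp add: k' power_add power_mult mult_ac)
      also have "\<dots> \<le> real K ^ A'"
        using K by (intro power_increasing) (auto simp: A'_def)
      finally show ?thesis .
    next
      case False
      then have j: "j \<in> {1..k}"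
        using that by auto
      have "int_dist (real (r * q ^ k) * b j) * real N ^ j \<le>
          real (Suc k * 2 ^ k * q ^ k * (K ^ (c' + 1)) ^ k) * real (4 * K) ^ A"
        using q(1) s NL r(3) K j unfolding \<gamma>_def
        by (intro int_dist_coeffs_affine[where L = L and s = s]) auto
      also have "\<dots> = real (Suc k * 2 ^ k * q ^ k * (K ^ (c' + 1)) ^ k * (4 * K) ^ A)"
        by simp
      also have "\<dots> \<le> real (K ^ Suc k * K ^ k * (K ^ c) ^ k * (K ^ (c' + 1)) ^ k * K ^ (3 * A))"
      proof -
        have "Suc k \<le> 2 ^ Suc k"
          using less_exp[of "Suc k"] by (rule less_imp_le)
        also have "\<dots> \<le> K ^ Suc k"
          using K by (intro power_mono) auto
        finally show ?thesis
          using K K4 q(2) by (intro of_nat_mono mult_le_mono power_mono) auto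
      qed
      also have "\<dots> = real K ^ (Suc k + k + c * k + (c' + 1) * k + 3 * A)"
        by (simp only: power_add power_mult of_nat_mult of_nat_power)
      also have "\<dots> \<le> real K ^ A'"
        using K unfolding A'_def by (intro power_increasing le_add2) auto
      finally show ?thesis .
    qed
    moreover have "r * q ^ k \<ge> 1"
      using r(1) q(1) by simp
    moreover have "r * q ^ k \<le> K ^ A'"
    proof (rule order_trans[OF r_le])
      show "K ^ (c * k + 3 * A) \<le> K ^ A'"
        using K by (intro power_increasing) (auto simp: A'_def)
    qed
    ultimately show ?thesis
      by blast
  qed
  then show ?thesis
    unfolding weyl_inverse_def by blast
qed

lemma weyl_inverse_exists:
  assumes "k \<ge> 1"
  shows "\<exists>A. weyl_inverse k A"
  using assms
proof (induction k rule: nat_induct_at_least)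
  case base
  then show ?case
    using weyl_inverse_1 by blast
next
  case (Suc k)
  then show ?case
    using weyl_inverse_Suc by blast
qed

section \<open>Non-Liouville linear coefficient\<close>

text \<open>The fraction \<open>a / q\<close> is written as \<open>2 * a / (2 * q)\<close>, so that
  \<open>q = 1\<close> also meets the demand for a denominator above 1; hence the factor 2.\<close>

lemma not_liouville_int_dist:
  assumes "\<not> liouville \<alpha>"
  obtains n :: nat where "n \<ge> 1" "\<And>q. q \<ge> 1 \<Longrightarrow> int_dist (real q * \<alpha>) * (2 * real q) ^ n > real q"
proof -
  obtain n :: nat where n: "n \<ge> 1"
      "\<And>p q :: int. q > 1 \<Longrightarrow> \<bar>\<alpha> - of_int p / of_int q\<bar> > of_int q powi (- int n)"
    using assms unfolding liouville_def by (meson not_le)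
  have "int_dist (real q * \<alpha>) * (2 * real q) ^ n > real q" if q: "q \<ge> 1" for q :: nat
  proof -
    obtain a :: int where a: "\<bar>real q * \<alpha> - of_int a\<bar> = int_dist (real q * \<alpha>)"
      by (rule int_dist_obtain)
    have "of_int (2 * int q) powi (- int n) < \<bar>\<alpha> - of_int (2 * a) / of_int (2 * int q)\<bar>"
      using q by (intro n(2)) auto
    also have "of_int (2 * int q) powi (- int n) = 1 / (2 * real q) ^ n"
      by (simp add: power_int_minus divide_inverse)
    also have "\<bar>\<alpha> - of_int (2 * a) / of_int (2 * int q)\<bar> = int_dist (real q * \<alpha>) / real q"
    proof -
      have "\<alpha> - of_int (2 * a) / of_int (2 * int q) = (real q * \<alpha> - of_int a) / real q"
        using q by (simp add: field_simps)
      then show ?thesis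
        using a by (simp add: abs_divide)
    qed
    finally show ?thesis
      using q by (simp add: field_simps)
  qed
  then show ?thesis
    using n(1) that by blast
qed

text \<open>In the resulting linear coefficient \<open>d\<close> cancels, which makes the final
  bound uniform in \<open>d\<close>. Padding to degree at least 1 ensures that this coefficient is
  present even for constant \<open>P\<close>.\<close>

lemma poly_dilate:
  fixes P :: "real poly"
  assumes d: "d \<ge> 1"
  defines "k \<equiv> max 1 (degree P)"
  shows "real m * (poly P (real d * x) / real d) =
    polyfun k (\<lambda>j. real m * coeff P j * real d ^ j / real d) x"
proof -
  have "poly P (real d * x) = (\<Sum>i\<le>k. coeff P i * (real d * x) ^ i)"
    unfolding poly_altdef by (intro sum.mono_neutral_left) (auto simp: k_def coeff_eq_0)
  then show ?thesis
    by (simp add: polyfun_def sum_distrib_left sum_divide_distrib power_mult_distrib mult_ac)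
qed

text \<open>Here \<open>q * m\<close> is a denominator for \<open>\<alpha>\<close>. The upper bound
  on its distance and the non-Liouville lower bound are compatible only if \<open>N\<close> is small
  in terms of \<open>B\<close> and \<open>m\<close>.\<close>

lemma diophantine_lower_bound:
  fixes \<alpha> :: real and q m N B n :: nat
  assumes n: "int_dist (real (q * m) * \<alpha>) * (2 * real (q * m)) ^ n > real (q * m)"
    and "q * m \<ge> 1" "q \<le> B" and B: "int_dist (real q * (real m * \<alpha>)) * real N \<le> real B"
  shows "real N \<le> real B * (2 * (real B * real m)) ^ n"
proof -
  have "real N * 1 \<le> real N * real (q * m)"
    using assms(2) by (intro mult_left_mono) (auto simp flip: of_nat_mult)
  also have "\<dots> \<le> real N * (int_dist (real (q * m) * \<alpha>) * (2 * real (q * m)) ^ n)"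
    using n by (intro mult_left_mono) auto
  also have "\<dots> = (int_dist (real q * (real m * \<alpha>)) * real N) * (2 * real (q * m)) ^ n"
    by (simp add: mult_ac)
  also have "\<dots> \<le> real B * (2 * real (q * m)) ^ n"
    using B by (intro mult_right_mono) auto
  also have "\<dots> \<le> real B * (2 * (real B * real m)) ^ n"
    using assms(3) by (intro mult_left_mono power_mono) (auto intro!: mult_right_mono)
  finally show ?thesis
    by simp
qed

theorem theorem3p1:
  fixes P :: "real poly"
  assumes "\<not> liouville (coeff P 1)"
  shows "\<exists>\<tau> \<rho> X0 :: real. \<tau> > 0 \<and> \<rho> > 0 \<and> X0 > 0 \<and>
    (\<forall>(d::nat) (m::nat) (X::real).
       d \<ge> 1 \<longrightarrow> m \<ge> 1 \<longrightarrow> real m < X powr \<rho> \<longrightarrow> X \<ge> X0 \<longrightarrow>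
       norm (exp_sum P d m X) \<le> X powr (1 - \<tau>))"
proof -
  define k where "k = max 1 (degree P)"
  obtain A where A: "weyl_inverse k A"
    using weyl_inverse_exists[of k] by (auto simp: k_def)
  obtain n where n: "n \<ge> 1"
      "\<And>q. q \<ge> 1 \<Longrightarrow> int_dist (real q * coeff P 1) * (2 * real q) ^ n > real q"
    using not_liouville_int_dist[OF assms] by blast
  \<comment> \<open>The final bound for \<open>N\<close> has exponent
    \<open>\<tau> * A * (n + 1) + \<rho> * n\<close> in \<open>X\<close>; each part is made at most
    \<open>1/4\<close>, for a total of at most \<open>1/2\<close>. Using \<open>A + 1\<close> avoids
    division by zero when \<open>A = 0\<close>.\<close>
  define \<tau> where "\<tau> = 1 / (4 * (real A + 1) * (real n + 1))"
  define \<rho> where "\<rho> = 1 / (4 * real n)"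
  \<comment> \<open>The powers of \<open>2 ^ A\<close> come from rounding
    \<open>X powr \<tau>\<close> up to an integer, the outer 2 from \<open>X < 2 * N\<close>. The
    choice of \<open>X0\<close> makes \<open>X < C * sqrt X\<close> impossible.\<close>
  define C :: real where "C = 2 * (2 ^ A * (2 * 2 ^ A) ^ n)"
  define X0 where "X0 = C\<^sup>2 + 2"
  have \<tau>: "\<tau> > 0" and \<rho>: "\<rho> > 0"
    using n(1) by (auto simp: \<tau>_def \<rho>_def)
  have C0: "C > 0"
    by (simp add: C_def)
  have X00: "X0 > 0"
    by (simp add: X0_def add_nonneg_pos)
  have \<tau>A: "\<tau> * (real A * (real n + 1)) \<le> 1/4"
  proof -
    have "\<tau> * (real A * (real n + 1)) \<le> \<tau> * ((real A + 1) * (real n + 1))"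
      using \<tau> by (intro mult_left_mono mult_right_mono) auto
    also have "\<dots> = 1/4"
      unfolding \<tau>_def using n(1) by (simp add: divide_simps)
    finally show ?thesis .
  qed
  have \<rho>n: "\<rho> * real n = 1/4"
    unfolding \<rho>_def using n(1) by (simp add: divide_simps)
  have "norm (exp_sum P d m X) \<le> X powr (1 - \<tau>)"
    if d: "d \<ge> 1" and m: "m \<ge> 1" and mX: "real m < X powr \<rho>" and X: "X \<ge> X0" for d m :: nat and X :: real
  proof (rule ccontr)
    assume "\<not> ?thesis"
    then have large: "X powr (1 - \<tau>) < norm (exp_sum P d m X)"
      by simp
    have X2: "X \<ge> 2" and XC: "X > C\<^sup>2"
      using X unfolding X0_def by (auto intro: order_trans[of _ "C\<^sup>2 + 2"])
    define N where "N = nat \<lfloor>X\<rfloor>"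
    have N: "real N \<le> X" and N2: "X / 2 < real N"
      using X2 unfolding N_def by linarith+
    define b where "b j = real m * coeff P j * real d ^ j / real d" for j
    have b1: "b 1 = real m * coeff P 1"
      using d by (simp add: b_def)
    have "{x::nat. x \<ge> 1 \<and> real x \<le> X} = {1..N}"
      using N by (auto simp: N_def le_nat_floor)
    then have S: "exp_sum P d m X = (\<Sum>x=1..N. e (polyfun k b (real x)))"
      unfolding exp_sum_def poly_dilate[OF d] b_def k_def by simp
    define K where "K = nat \<lceil>X powr \<tau>\<rceil>"
    have X\<tau>: "X powr \<tau> > 1"
      using X2 \<tau> by simp
    have K1: "X powr \<tau> \<le> real K" and K2: "K \<ge> 2" and K3: "real K \<le> 2 * X powr \<tau>"
      using X\<tau> unfolding K_def by linarith+
    have "real N \<le> X powr \<tau> * X powr (1 - \<tau>)"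
      using N X2 by (simp flip: powr_add)
    also have "\<dots> \<le> real K * norm (exp_sum P d m X)"
      using K1 large by (intro mult_mono) auto
    \<comment> \<open>Only the linear coefficient \<open>m * \<alpha>\<close> is extracted from the
      simultaneous approximation.\<close>
    finally obtain q where q: "q \<ge> 1" "q \<le> K ^ A" "int_dist (real q * b 1) * real N ^ 1 \<le> real K ^ A"
      using A K2 unfolding weyl_inverse_def S k_def by (metis atLeastAtMost_iff max.cobounded1 order_refl)
    define Y where "Y = X powr \<tau>"
    have KA: "real (K ^ A) \<le> 2 ^ A * Y ^ A"
      using K3 unfolding of_nat_power Y_def power_mult_distrib[symmetric] by (intro power_mono) auto
    have "real N \<le> real (K ^ A) * (2 * (real (K ^ A) * real m)) ^ n"
      using q m b1 by (intro diophantine_lower_bound[of q m "coeff P 1"] n(2)) auto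
    also have "\<dots> \<le> (2 ^ A * Y ^ A) * (2 * ((2 ^ A * Y ^ A) * X powr \<rho>)) ^ n"
      using KA mX by (intro mult_mono power_mono) (auto simp: Y_def)
    also have "\<dots> = (2 ^ A * (2 * 2 ^ A) ^ n) * (Y ^ (A * (n + 1)) * (X powr \<rho>) ^ n)"
      by (simp add: power_mult_distrib power_add power_mult mult_ac)
    also have "Y ^ (A * (n + 1)) = X powr (\<tau> * (real A * (real n + 1)))"
      using X2 unfolding Y_def by (subst powr_power) (auto simp: algebra_simps)
    also have "(X powr \<rho>) ^ n = X powr (1/4)"
      unfolding \<rho>n[symmetric] using X2 by (subst powr_power) (auto simp: mult.commute)
    also have "X powr (\<tau> * (real A * (real n + 1))) * X powr (1/4) \<le> X powr (1/4) * X powr (1/4)"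
      using X2 \<tau>A by (intro mult_right_mono powr_mono) auto
    also have "\<dots> = sqrt X"
      using X2 by (simp add: powr_half_sqrt flip: powr_add)
    finally have "real N \<le> (2 ^ A * (2 * 2 ^ A) ^ n) * sqrt X"
      by simp
    then have "X < C * sqrt X"
      using N2 by (simp add: C_def)
    moreover have sq: "X = sqrt X * sqrt X"
      using X2 by simp
    ultimately have "sqrt X * sqrt X < C * sqrt X"
      by linarith
    then have "sqrt X < C"
      by (rule mult_right_less_imp_less) (use X2 in simp)
    then have "sqrt X * sqrt X < C * C"
      using C0 X2 by (intro mult_strict_mono) auto
    then show False
      using sq XC unfolding power2_eq_square by linarith
  qed
  then show ?thesis
    using \<tau> \<rho> X00 by blast
qed

end
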